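(* Every non-discrete locally compact totally disconnected group contains an unconditionally $f_\omega$-productive sequence.
   Context: All topological groups are Hausdorff; $\mathbb N=\{0,1,2,\dots\}$. Products are ordered: $\prod_{n=0}^m b_n=b_0b_1\cdots b_m$. A sequence $\{b_n:n\in\mathbb N\}$ in a topological group $G$ is productive if $\{\prod_{n=0}^m b_n:m\in\mathbb N\}$ converges to some element of $G$. A sequence $\{a_n:n\in\mathbb N\}$ in $G$ is $f_\omega$-productive if it is faithfully indexed ($a_n\ne a_m$ for $n\neq m$) and $\{a_n^{z(n)}:n\in\mathbb N\}$ is productive for every function $z:\mathbb N\to\mathbb Z$. ($f_\omega$ is the constant function with value $\omega$.) It is unconditionally $f_\omega$-productive if it is faithfully indexed and $\{a_{\varphi(n)}:n\in\mathbb N\}$ is $f_\omega$-productive for every bijection $\varphi:\mathbb N\to\mathbb N$. *)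

theory Defs
  imports "HOL-Analysis.Analysis" "HOL-Algebra.Group"
begin

locale topological_group = group G for G (structure) +
  fixes T :: "'a topology"
  assumes topspace_eq_carrier: "topspace T = carrier G"
    and continuous_mult: "continuous_map (prod_topology T T) T (\<lambda>(x, y). x \<otimes> y)"
    and continuous_inv: "continuous_map T T (\<lambda>x. inv x)"
    and Hausdorff: "Hausdorff_space T"

definition totally_disconnected_space :: "'a topology \<Rightarrow> bool" where
  "totally_disconnected_space T \<longleftrightarrow>
     (\<forall>x\<in>topspace T. connected_component_of_set T x = {x})"

text \<open>The group need not be commutative: the factors are multiplied from left to right
  in the order of their indices, so \<open>finprod\<close> does not apply.\<close>

primrec ordered_prod :: "('a, 'm) monoid_scheme \<Rightarrow> (nat \<Rightarrow> 'a) \<Rightarrow> nat \<Rightarrow> 'a" where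
  "ordered_prod G b 0 = b 0"
| "ordered_prod G b (Suc m) = ordered_prod G b m \<otimes>\<^bsub>G\<^esub> b (Suc m)"

definition productive ::
    "('a, 'm) monoid_scheme \<Rightarrow> 'a topology \<Rightarrow> (nat \<Rightarrow> 'a) \<Rightarrow> bool" where
  "productive G T b \<longleftrightarrow>
     range b \<subseteq> carrier G \<and> (\<exists>g\<in>carrier G. limitin T (ordered_prod G b) g sequentially)"

definition f_omega_productive ::
    "('a, 'm) monoid_scheme \<Rightarrow> 'a topology \<Rightarrow> (nat \<Rightarrow> 'a) \<Rightarrow> bool" where
  "f_omega_productive G T a \<longleftrightarrow>
     range a \<subseteq> carrier G \<and> inj a \<and>
     (\<forall>z :: nat \<Rightarrow> int. productive G T (\<lambda>n. a n [^]\<^bsub>G\<^esub> z n))"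

definition unconditionally_f_omega_productive ::
    "('a, 'm) monoid_scheme \<Rightarrow> 'a topology \<Rightarrow> (nat \<Rightarrow> 'a) \<Rightarrow> bool" where
  "unconditionally_f_omega_productive G T a \<longleftrightarrow>
     range a \<subseteq> carrier G \<and> inj a \<and>
     (\<forall>\<phi> :: nat \<Rightarrow> nat. bij \<phi> \<longrightarrow> f_omega_productive G T (\<lambda>n. a (\<phi> n)))"

end

theory Submission
  imports Defs "HOL-Algebra.Generated_Groups"
begin

text \<open>By van Dantzig's theorem the compact open subgroups form a neighbourhood base at the
  identity, so every injective sequence converging to the identity is unconditionally
  \<open>f\<^sub>\<omega>\<close>-productive: a compact open subgroup contains almost all of its terms together with
  all their powers, so the partial products are eventually in one coset of the subgroup, and
  these compact cosets have a common point. To find such a sequence without metrizability, choose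
  a strictly decreasing sequence of compact open subgroups \<open>N n\<close> and \<open>x n \<in> N n - N (n + 1)\<close>.
  The cosets \<open>x n S\<close> of \<open>S = (\<Inter>n. N n)\<close> converge to \<open>S\<close>. Zorn's lemma shrinks \<open>S\<close> and the
  cosets simultaneously, retaining convergence, until the subgroup is trivial and the cosets
  are points.\<close>

text \<open>Compact sets are closed here, so \<open>U\<close> and the complements of the members of
  \<open>\<S>\<close> form an open cover of any member \<open>K\<close>. A finite subcover involves
  finitely many members, and directedness yields a single member inside all of them and inside
  \<open>K\<close>; it can only be covered by \<open>U\<close>. The case \<open>U = {}\<close> is
  the finite intersection property.\<close>

lemma compactin_directed_Inter_subset:
  assumes "Hausdorff_space X" "\<S> \<noteq> {}"
    and comp: "\<And>S. S \<in> \<S> \<Longrightarrow> compactin X S"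
    and dir: "\<And>A B. A \<in> \<S> \<Longrightarrow> B \<in> \<S> \<Longrightarrow> \<exists>C\<in>\<S>. C \<subseteq> A \<inter> B"
    and U: "openin X U" "\<Inter>\<S> \<subseteq> U"
  shows "\<exists>S\<in>\<S>. S \<subseteq> U"
proof -
  obtain K where K: "K \<in> \<S>"
    using assms(2) by blast
  let ?c = "\<lambda>S. topspace X - S"
  have "openin X V" if "V \<in> insert U (?c ` \<S>)" for V
    using that U(1) comp compactin_imp_closedin[OF assms(1)] by (auto simp: closedin_def)
  moreover have "K \<subseteq> \<Union>(insert U (?c ` \<S>))"
    using U(2) compactin_subset_topspace[OF comp[OF K]] by blast
  ultimately obtain \<F> where \<F>: "finite \<F>" "\<F> \<subseteq> insert U (?c ` \<S>)" "K \<subseteq> \<Union>\<F>"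
    using comp[OF K] unfolding compactin_def by metis
  have "finite (\<F> - {U})" "\<F> - {U} \<subseteq> ?c ` \<S>"
    using \<F> by auto
  then obtain \<G> where \<G>: "finite \<G>" "\<G> \<subseteq> \<S>" "\<F> - {U} = ?c ` \<G>"
    by (meson finite_subset_image)
  have "\<exists>S\<in>\<S>. S \<subseteq> K \<inter> \<Inter>\<G>"
    using \<G>(1,2)
  proof (induction \<G> rule: finite_induct)
    case empty
    then show ?case using K by auto
  next
    case (insert A \<G>)
    then obtain S where S: "S \<in> \<S>" "S \<subseteq> K \<inter> \<Inter>\<G>" by auto
    moreover obtain C where "C \<in> \<S>" "C \<subseteq> A \<inter> S"
      using insert.prems dir[of A S] S(1) by blast
    ultimately have "C \<subseteq> K \<inter> \<Inter>(insert A \<G>)" by blast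
    with \<open>C \<in> \<S>\<close> show ?case ..
  qed
  then obtain S where S: "S \<in> \<S>" "S \<subseteq> K \<inter> \<Inter>\<G>" by blast
  have "S \<subseteq> U"
  proof
    fix x assume x: "x \<in> S"
    with S \<F>(3) obtain F where F: "F \<in> \<F>" "x \<in> F" by blast
    show "x \<in> U"
    proof (rule ccontr)
      assume "x \<notin> U"
      with F \<G>(3) have "F \<in> ?c ` \<G>" by blast
      with F x S show False by blast
    qed
  qed
  with S show ?thesis by blast
qed

section \<open>Cosets, ordered products and stabilizers in groups\<close>

context group
begin

lemma mem_l_coset_iff:
  assumes "subgroup H G" "x \<in> carrier G"
  shows "y \<in> x <# H \<longleftrightarrow> y \<in> carrier G \<and> inv x \<otimes> y \<in> H"
proof
  assume y: "y \<in> x <# H"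
  then obtain h where h: "h \<in> H" "y = x \<otimes> h"
    by (auto simp: l_coset_def)
  moreover have "h \<in> carrier G"
    using assms(1) h(1) by (rule subgroup.mem_carrier)
  ultimately show "y \<in> carrier G \<and> inv x \<otimes> y \<in> H"
    using assms(2) by (simp add: m_assoc [symmetric])
next
  assume y: "y \<in> carrier G \<and> inv x \<otimes> y \<in> H"
  then have "y = x \<otimes> (inv x \<otimes> y)"
    using assms(2) by (simp add: m_assoc [symmetric])
  with y show "y \<in> x <# H"
    unfolding l_coset_def by blast
qed

lemma ordered_prod_closed:
  assumes "range b \<subseteq> carrier G"
  shows "ordered_prod G b n \<in> carrier G"
  by (induction n) (use assms in auto)

text \<open>For a compact open neighbourhood \<open>A\<close> of the identity, this stabilizer is
  the compact open subgroup produced inside \<open>A\<close>.\<close>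

lemma subgroup_right_stabilizer:
  assumes "A \<subseteq> carrier G"
  shows "subgroup {g \<in> carrier G. A #> g = A} G"
proof (rule subgroupI)
  show "{g \<in> carrier G. A #> g = A} \<noteq> {}"
    using assms by (auto intro!: exI[of _ \<one>])
next
  fix g assume g: "g \<in> {g \<in> carrier G. A #> g = A}"
  then have "A #> inv g = (A #> g) #> inv g" by simp
  also have "\<dots> = A"
    using g assms by (subst coset_mult_assoc) auto
  finally show "inv g \<in> {g \<in> carrier G. A #> g = A}"
    using g by simp
next
  fix g h
  assume gh: "g \<in> {g \<in> carrier G. A #> g = A}" "h \<in> {g \<in> carrier G. A #> g = A}"
  then have "A #> (g \<otimes> h) = (A #> g) #> h"
    using assms by (subst coset_mult_assoc) auto
  with gh show "g \<otimes> h \<in> {g \<in> carrier G. A #> g = A}" by simp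
qed auto

end

section \<open>Translations and open subgroups\<close>

context topological_group
begin

lemma continuous_map_left_translation:
  assumes "x \<in> carrier G"
  shows "continuous_map T T (\<lambda>y. x \<otimes> y)"
proof -
  have "continuous_map T (prod_topology T T) (\<lambda>y. (x, y))"
    using assms by (simp add: continuous_map_pairedI topspace_eq_carrier)
  from continuous_map_compose[OF this continuous_mult] show ?thesis
    by (simp add: o_def)
qed

lemma continuous_map_right_translation:
  assumes "x \<in> carrier G"
  shows "continuous_map T T (\<lambda>y. y \<otimes> x)"
proof -
  have "continuous_map T (prod_topology T T) (\<lambda>y. (y, x))"
    using assms by (simp add: continuous_map_pairedI topspace_eq_carrier)
  from continuous_map_compose[OF this continuous_mult] show ?thesis
    by (simp add: o_def)
qed

lemma openin_left_translate:
  assumes "openin T U" "x \<in> carrier G"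
  shows "openin T {y \<in> carrier G. x \<otimes> y \<in> U}"
  using openin_continuous_map_preimage[OF continuous_map_left_translation[OF assms(2)] assms(1)]
  by (simp add: topspace_eq_carrier)

lemma openin_right_translate:
  assumes "openin T U" "x \<in> carrier G"
  shows "openin T {y \<in> carrier G. y \<otimes> x \<in> U}"
  using openin_continuous_map_preimage[OF continuous_map_right_translation[OF assms(2)] assms(1)]
  by (simp add: topspace_eq_carrier)

lemma compactin_l_coset:
  assumes "compactin T S" "x \<in> carrier G"
  shows "compactin T (x <# S)"
proof -
  have "x <# S = (\<lambda>y. x \<otimes> y) ` S"
    by (auto simp: l_coset_def)
  then show ?thesis
    using image_compactin[OF assms(1) continuous_map_left_translation[OF assms(2)]] by simp
qed

text \<open>Around each \<open>g\<close> in \<open>H\<close> the translate of \<open>W\<close> by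
  \<open>g\<close> is an open set that stays inside \<open>H\<close>.\<close>

lemma openin_subgroup:
  assumes H: "subgroup H G" and W: "openin T W" "\<one> \<in> W" "W \<subseteq> H"
  shows "openin T H"
proof (subst openin_subopen, intro ballI)
  fix g assume g: "g \<in> H"
  then have gc: "g \<in> carrier G"
    by (rule subgroup.mem_carrier[OF H])
  let ?V = "{y \<in> carrier G. inv g \<otimes> y \<in> W}"
  have "y \<in> H" if "y \<in> ?V" for y
  proof -
    have "g \<otimes> (inv g \<otimes> y) \<in> H"
      by (rule subgroup.m_closed[OF H g]) (use that W(3) in blast)
    then show ?thesis
      using that gc by (simp add: m_assoc [symmetric])
  qed
  moreover have "openin T ?V"
    using W(1) gc by (intro openin_left_translate) auto
  ultimately show "\<exists>V. openin T V \<and> g \<in> V \<and> V \<subseteq> H"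
    using gc W(2) by (intro exI[of _ ?V]) auto
qed

lemma openin_one_imp_discrete:
  assumes "openin T {\<one>}"
  shows "T = discrete_topology (carrier G)"
proof -
  have "openin T {x}" if "x \<in> carrier G" for x
  proof -
    have "{y \<in> carrier G. inv x \<otimes> y \<in> {\<one>}} = {x}"
      using that by (auto simp: inv_solve_left')
    then show ?thesis
      using openin_left_translate[OF assms, of "inv x"] that by simp
  qed
  then have "discrete_topology (carrier G) = T"
    by (subst discrete_topology_unique) (auto simp: topspace_eq_carrier)
  then show ?thesis ..
qed

lemma openin_avoiding:
  assumes "x \<in> carrier G" "x \<noteq> \<one>"
  obtains U where "openin T U" "\<one> \<in> U" "x \<notin> U"
  using Hausdorff assms unfolding Hausdorff_space_def topspace_eq_carrier disjnt_iff
  by (metis one_closed)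

section \<open>Compact open subgroups and van Dantzig's theorem\<close>

definition compact_open_subgroup :: "'a set \<Rightarrow> bool" where
  "compact_open_subgroup H \<longleftrightarrow> subgroup H G \<and> openin T H \<and> compactin T H"

lemma compact_open_subgroup_Int:
  assumes "compact_open_subgroup H" "compact_open_subgroup K"
  shows "compact_open_subgroup (H \<inter> K)"
  using assms unfolding compact_open_subgroup_def
  by (auto intro: subgroups_Inter_pair compactin_Int[OF Hausdorff]) 

text \<open>The right stabilizer \<open>H\<close> of \<open>A\<close> lies in \<open>A\<close>
  because \<open>A\<close> contains the identity. Compactness of \<open>A\<close> makes
  \<open>H\<close> a neighbourhood of the identity, hence open; an open subgroup is closed, and a
  closed subset of \<open>A\<close> is compact.\<close>

lemma compact_open_nbhd_contains_subgroup:
  assumes A: "openin T A" "compactin T A" "\<one> \<in> A"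
  shows "\<exists>H. compact_open_subgroup H \<and> H \<subseteq> A"
proof -
  have Ac: "A \<subseteq> carrier G"
    using openin_subset[OF A(1)] by (simp add: topspace_eq_carrier)
  define H where "H = {g \<in> carrier G. A #> g = A}"
  have H: "subgroup H G"
    unfolding H_def by (rule subgroup_right_stabilizer[OF Ac])
  \<comment> \<open>The open set \<open>?P\<close> contains the compact slice
    \<open>A \<times> {\<one>}\<close>, so the tube lemma gives a neighbourhood \<open>V\<close> of
    the identity with \<open>A #> v \<subseteq> A\<close> for all \<open>v\<close> in
    \<open>V\<close>.\<close>
  let ?P = "{p \<in> topspace (prod_topology T T). (case p of (x, y) \<Rightarrow> x \<otimes> y) \<in> A}"
  have "openin (prod_topology T T) ?P"
    by (rule openin_continuous_map_preimage[OF continuous_mult A(1)])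
  moreover have "A \<times> {\<one>} \<subseteq> ?P"
    using Ac by (auto simp: topspace_eq_carrier)
  ultimately obtain U V where UV: "openin T V" "A \<subseteq> U" "\<one> \<in> V" "U \<times> V \<subseteq> ?P"
    using tube_lemma_left[of T T ?P A \<one>] A(2) by (auto simp: topspace_eq_carrier)
  have Vc: "V \<subseteq> carrier G"
    using openin_subset[OF UV(1)] by (simp add: topspace_eq_carrier)
  have AV: "A #> v \<subseteq> A" if "v \<in> V" for v
  proof -
    have "(x, v) \<in> ?P" if "x \<in> A" for x
      using UV(2,4) that \<open>v \<in> V\<close> by blast
    then show ?thesis
      by (auto simp: r_coset_def)
  qed
  \<comment> \<open>Symmetrizing \<open>V\<close> turns the inclusion into an equality: applied to
    \<open>inv w\<close>, it gives \<open>A \<subseteq> A #> w\<close>.\<close>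
  define W where "W = V \<inter> {y \<in> carrier G. inv y \<in> V}"
  have "openin T W"
    unfolding W_def
    using openin_continuous_map_preimage[OF continuous_inv UV(1)] UV(1)
    by (intro openin_Int) (auto simp: topspace_eq_carrier)
  moreover have "\<one> \<in> W"
    using UV(3) by (simp add: W_def)
  moreover have "W \<subseteq> H"
  proof
    fix w assume w: "w \<in> W"
    then have wc: "w \<in> carrier G" and inv: "inv w \<in> V" and "w \<in> V"
      by (auto simp: W_def)
    have "A \<subseteq> A #> w"
    proof
      fix a assume a: "a \<in> A"
      then have "a \<otimes> inv w \<in> A"
        using AV[OF inv] by (auto simp: r_coset_def)
      moreover have "a = (a \<otimes> inv w) \<otimes> w"
        using a Ac wc by (simp add: m_assoc subset_iff)
      ultimately show "a \<in> A #> w"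
        by (auto simp: r_coset_def)
    qed
    with AV[OF \<open>w \<in> V\<close>] wc show "w \<in> H"
      by (auto simp: H_def)
  qed
  ultimately have oH: "openin T H"
    using openin_subgroup[OF H] by blast
  have HA: "H \<subseteq> A"
  proof
    fix h assume h: "h \<in> H"
    then have "\<one> \<otimes> h \<in> A #> h"
      using A(3) by (auto simp: r_coset_def)
    with h show "h \<in> A"
      by (simp add: H_def)
  qed
  \<comment> \<open>The left coset of \<open>H\<close> through a point outside \<open>H\<close> is
    open and misses \<open>H\<close>.\<close>
  have "closedin T H"
    unfolding closedin_def
  proof
    show "H \<subseteq> topspace T"
      by (rule openin_subset[OF oH])
    show "openin T (topspace T - H)"
    proof (subst openin_subopen, intro ballI)
      fix y assume y: "y \<in> topspace T - H"
      then have yc: "y \<in> carrier G"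
        by (simp add: topspace_eq_carrier)
      have "z \<notin> H" if z: "z \<in> carrier G" "inv y \<otimes> z \<in> H" for z
      proof
        assume "z \<in> H"
        then have "z \<otimes> inv (inv y \<otimes> z) \<in> H"
          using z H by (simp add: subgroup.m_closed subgroup.m_inv_closed)
        moreover have "z \<otimes> inv (inv y \<otimes> z) = y"
          using z yc by (simp add: inv_mult_group m_assoc [symmetric])
        ultimately show False
          using y by simp
      qed
      then show "\<exists>V. openin T V \<and> y \<in> V \<and> V \<subseteq> topspace T - H"
        using yc subgroup.one_closed[OF H] openin_left_translate[OF oH, of "inv y"]
        by (intro exI[of _ "{z \<in> carrier G. inv y \<otimes> z \<in> H}"]) (auto simp: topspace_eq_carrier)
    qed
  qed
  then have "compactin T H"
    using closed_compactin[OF A(2) HA] by blast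
  with H oH HA show ?thesis
    unfolding compact_open_subgroup_def by blast
qed

theorem van_Dantzig:
  assumes "locally_compact_space T" "totally_disconnected_space T"
    and U: "openin T U" "\<one> \<in> U"
  shows "\<exists>H. compact_open_subgroup H \<and> H \<subseteq> U"
proof -
  have one: "\<one> \<in> topspace T"
    by (simp add: topspace_eq_carrier)
  then obtain V K where VK: "openin T V" "compactin T K" "\<one> \<in> V" "V \<subseteq> K"
    using assms(1) unfolding locally_compact_space_def by blast
  have "{\<one>} \<in> connected_components_of T"
    using assms(2) one unfolding totally_disconnected_space_def connected_components_of_def
    by (metis imageI)
  \<comment> \<open>The component of the identity is a point, hence compact, so a clopen set
    \<open>A\<close> separates it from the complement of \<open>U \<inter> V\<close>. Intersecting
    with \<open>V\<close> puts \<open>A\<close> inside the compact set \<open>K\<close>.\<close>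
  moreover have "closedin T (topspace T - U \<inter> V)"
    using U VK by blast
  ultimately have "separated_between T {\<one>} (topspace T - U \<inter> V)"
    using assms(1) Hausdorff one U VK
    by (intro separated_between_compact_connected_component) auto
  then obtain A where A: "closedin T A" "openin T A" "\<one> \<in> A"
      "topspace T - U \<inter> V \<subseteq> topspace T - A"
    unfolding separated_between by blast
  then have AUV: "A \<subseteq> U \<inter> V"
    using openin_subset[OF A(2)] by blast
  then have "compactin T A"
    using closed_compactin[OF VK(2) _ A(1)] VK(4) by blast
  with compact_open_nbhd_contains_subgroup[OF A(2)] A(3) AUV show ?thesis
    by blast
qed

end

section \<open>Convergence of ordered products\<close>

locale locally_profinite_group = topological_group +
  assumes compact_open_subgroup_base:
    "openin T U \<Longrightarrow> \<one> \<in> U \<Longrightarrow> \<exists>H. compact_open_subgroup H \<and> H \<subseteq> U"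
begin

text \<open>Right multiplication by elements of \<open>H\<close> preserves left cosets of
  \<open>H\<close>, so the partial products are eventually in one coset. Compactness supplies the
  limit as a point common to all these cosets.\<close>

lemma productive_if_eventually_in_subgroups:
  assumes b: "range b \<subseteq> carrier G"
    and ev: "\<And>H. compact_open_subgroup H \<Longrightarrow> \<exists>N. \<forall>n\<ge>N. b n \<in> H"
  shows "productive G T b"
proof -
  let ?p = "ordered_prod G b"
  have pc: "?p n \<in> carrier G" for n
    using b by (rule ordered_prod_closed)
  \<comment> \<open>The bound \<open>k\<close> lets one index serve beyond two given indices when
    directedness is shown.\<close>
  have tail: "\<exists>N\<ge>k. \<forall>m\<ge>N. ?p m \<in> ?p N <# H" if H: "compact_open_subgroup H" for H k
  proof -
    have sH: "subgroup H G"
      using H by (simp add: compact_open_subgroup_def)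
    obtain N where N: "\<And>n. n \<ge> N \<Longrightarrow> b n \<in> H"
      using ev[OF H] by blast
    have "?p m \<in> ?p (max k N) <# H" if "m \<ge> max k N" for m
      using that
    proof (induction m rule: dec_induct)
      case base
      then show ?case
        using pc subgroup.one_closed[OF sH] by (simp add: mem_l_coset_iff[OF sH])
    next
      case (step m)
      then have "b (Suc m) \<in> H"
        using N by simp
      with step.IH have "(inv (?p (max k N)) \<otimes> ?p m) \<otimes> b (Suc m) \<in> H"
        using pc by (simp add: mem_l_coset_iff[OF sH] subgroup.m_closed[OF sH])
      moreover have "b (Suc m) \<in> carrier G"
        using b by blast
      ultimately show ?case
        using pc by (simp add: mem_l_coset_iff[OF sH] m_assoc)
    qed
    then show ?thesis
      by (intro exI[of _ "max k N"]) auto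
  qed
  define \<D> where "\<D> = {?p n <# H | n H. compact_open_subgroup H \<and> (\<forall>m\<ge>n. ?p m \<in> ?p n <# H)}"
  have "\<D> \<noteq> {}"
  proof -
    obtain H where "compact_open_subgroup H"
      using compact_open_subgroup_base[of "topspace T"] openin_topspace[of T]
      by (auto simp: topspace_eq_carrier)
    with tail[of H 0] show ?thesis
      by (auto simp: \<D>_def)
  qed
  moreover have comp: "compactin T D" if "D \<in> \<D>" for D
    using that pc by (auto simp: \<D>_def compact_open_subgroup_def intro: compactin_l_coset)
  moreover have "\<exists>E\<in>\<D>. E \<subseteq> A \<inter> B" if AB: "A \<in> \<D>" "B \<in> \<D>" for A B
  proof -
    obtain n H where H: "A = ?p n <# H" "compact_open_subgroup H" "\<And>m. m \<ge> n \<Longrightarrow> ?p m \<in> ?p n <# H"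
      using AB(1) by (auto simp: \<D>_def)
    obtain k K where K: "B = ?p k <# K" "compact_open_subgroup K" "\<And>m. m \<ge> k \<Longrightarrow> ?p m \<in> ?p k <# K"
      using AB(2) by (auto simp: \<D>_def)
    have HK: "compact_open_subgroup (H \<inter> K)"
      using H(2) K(2) by (rule compact_open_subgroup_Int)
    obtain N where N: "N \<ge> max n k" "\<forall>m\<ge>N. ?p m \<in> ?p N <# (H \<inter> K)"
      using tail[OF HK] by blast
    have "subgroup H G" "subgroup K G"
      using H(2) K(2) by (auto simp: compact_open_subgroup_def)
    \<comment> \<open>Both cosets contain \<open>?p N\<close>, so both can be written with this
      representative; their intersection then contains its coset of
      \<open>H \<inter> K\<close>.\<close>
    then have "A = ?p N <# H" "B = ?p N <# K"
      using l_repr_independence[OF H(3)[of N]] l_repr_independence[OF K(3)[of N]] H(1) K(1) N(1) pc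
      by auto
    then have "?p N <# (H \<inter> K) \<subseteq> A \<inter> B"
      by (auto simp: l_coset_def)
    with HK N(2) show ?thesis
      by (auto simp: \<D>_def)
  qed
  moreover have "D \<noteq> {}" if "D \<in> \<D>" for D
    using that by (auto simp: \<D>_def)
  ultimately have "\<Inter>\<D> \<noteq> {}"
    using compactin_directed_Inter_subset[OF Hausdorff, of \<D> "{}"] by auto
  then obtain g where g: "\<And>D. D \<in> \<D> \<Longrightarrow> g \<in> D"
    by blast
  obtain D where "D \<in> \<D>"
    using \<open>\<D> \<noteq> {}\<close> by blast
  then have gc: "g \<in> carrier G"
    using g compactin_subset_topspace[OF comp] by (auto simp: topspace_eq_carrier)
  have "limitin T ?p g sequentially"
    unfolding limitin_sequentially
  proof (intro conjI allI impI)
    show "g \<in> topspace T"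
      using gc by (simp add: topspace_eq_carrier)
    fix U assume U: "openin T U \<and> g \<in> U"
    \<comment> \<open>Pulling \<open>U\<close> back by \<open>g\<close> gives an \<open>H\<close>
      with \<open>g <# H \<subseteq> U\<close>. The coset of \<open>H\<close> that holds a tail of
      the partial products contains \<open>g\<close>, so it is \<open>g <# H\<close>.\<close>
    then have "openin T {y \<in> carrier G. g \<otimes> y \<in> U}" "\<one> \<in> {y \<in> carrier G. g \<otimes> y \<in> U}"
      using gc openin_left_translate by auto
    then obtain H where H: "compact_open_subgroup H" "H \<subseteq> {y \<in> carrier G. g \<otimes> y \<in> U}"
      using compact_open_subgroup_base by meson
    obtain N where N: "\<forall>m\<ge>N. ?p m \<in> ?p N <# H"
      using tail[OF H(1), of 0] by blast
    then have "g \<in> ?p N <# H"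
      using H(1) by (intro g) (auto simp: \<D>_def)
    then have "?p N <# H = g <# H"
      using H(1) pc by (intro l_repr_independence) (auto simp: compact_open_subgroup_def)
    moreover have "g <# H \<subseteq> U"
      using H(2) by (auto simp: l_coset_def)
    ultimately show "\<exists>N. \<forall>n\<ge>N. ?p n \<in> U"
      using N by blast
  qed
  with b gc show ?thesis
    unfolding productive_def by blast
qed

text \<open>A subgroup that contains \<open>a n\<close> contains all its powers, and a bijection
  sends only finitely many indices below a given bound. So every rearranged sequence of powers is
  still eventually in each \<open>H\<close>.\<close>

lemma unconditionally_f_omega_productive_if_tendsto_one:
  assumes a: "range a \<subseteq> carrier G" "inj a"
    and ev: "\<And>H. compact_open_subgroup H \<Longrightarrow> \<exists>N. \<forall>n\<ge>N. a n \<in> H"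
  shows "unconditionally_f_omega_productive G T a"
  unfolding unconditionally_f_omega_productive_def f_omega_productive_def
proof (intro conjI a allI impI)
  fix \<phi> :: "nat \<Rightarrow> nat" assume \<phi>: "bij \<phi>"
  show "range (\<lambda>n. a (\<phi> n)) \<subseteq> carrier G"
    using a(1) by blast
  show "inj (\<lambda>n. a (\<phi> n))"
    using a(2) \<phi> by (auto simp: inj_def bij_def)
  fix z :: "nat \<Rightarrow> int"
  show "productive G T (\<lambda>n. a (\<phi> n) [^] z n)"
  proof (rule productive_if_eventually_in_subgroups)
    show "range (\<lambda>n. a (\<phi> n) [^] z n) \<subseteq> carrier G"
      using a(1) by (auto intro!: int_pow_closed)
    fix H assume H: "compact_open_subgroup H"
    obtain N where N: "\<And>n. n \<ge> N \<Longrightarrow> a n \<in> H"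
      using ev[OF H] by blast
    have "finite (\<phi> -` {..<N})"
      using \<phi> by (intro finite_vimageI) (auto simp: bij_def)
    then obtain M where M: "\<And>n. n \<in> \<phi> -` {..<N} \<Longrightarrow> n < M"
      using finite_nat_set_iff_bounded by meson
    have "a (\<phi> n) [^] z n \<in> H" if "n \<ge> M" for n
    proof -
      have "\<phi> n \<ge> N"
        using M[of n] that by (auto simp: not_less[symmetric])
      with N H show ?thesis
        using subgroup_int_pow_closed by (auto simp: compact_open_subgroup_def)
    qed
    then show "\<exists>M. \<forall>n\<ge>M. a (\<phi> n) [^] z n \<in> H" by blast
  qed
qed

section \<open>Convergent sequences of cosets\<close>

text \<open>The value at \<open>0\<close> is the subgroup of which all values are cosets and to which they
  converge.\<close>

definition convergent_cosets :: "(nat \<Rightarrow> 'a set) \<Rightarrow> bool" where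
  "convergent_cosets C \<longleftrightarrow> subgroup (C 0) G \<and> compactin T (C 0) \<and>
     (\<forall>n. \<exists>x\<in>carrier G. C n = x <# C 0) \<and>
     (\<forall>U. openin T U \<longrightarrow> C 0 \<subseteq> U \<longrightarrow> (\<exists>N. \<forall>n\<ge>N. C n \<subseteq> U))"

lemma convergent_cosetsD:
  assumes "convergent_cosets C"
  shows "subgroup (C 0) G" "compactin T (C 0)" "\<exists>x\<in>carrier G. C n = x <# C 0"
    and "openin T U \<Longrightarrow> C 0 \<subseteq> U \<Longrightarrow> \<exists>N. \<forall>n\<ge>N. C n \<subseteq> U"
  using assms by (simp_all add: convergent_cosets_def)

lemma convergent_cosets_eq:
  assumes "convergent_cosets C" "y \<in> C n"
  shows "y \<in> carrier G" "C n = y <# C 0"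
proof -
  obtain x where x: "x \<in> carrier G" "C n = x <# C 0" "subgroup (C 0) G"
    using convergent_cosetsD(1,3)[OF assms(1)] by blast
  then have y: "y \<in> x <# C 0"
    using assms(2) by simp
  show "y \<in> carrier G"
    using l_coset_carrier[OF y x(1,3)] .
  show "C n = y <# C 0"
    using l_repr_independence[OF y x(1,3)] x(2) by (rule trans[rotated])
qed

lemma convergent_cosets_nonempty:
  assumes "convergent_cosets C"
  shows "C n \<noteq> {}"
proof -
  obtain x where "C n = x <# C 0" "\<one> \<in> C 0"
    using convergent_cosetsD(3)[OF assms] subgroup.one_closed[OF convergent_cosetsD(1)[OF assms]]
    by blast
  then show ?thesis
    by (auto simp: l_coset_def)
qed

lemma convergent_cosets_compactin:
  assumes "convergent_cosets C"
  shows "compactin T (C n)"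
proof -
  obtain x where x: "x \<in> carrier G" "C n = x <# C 0"
    using convergent_cosetsD(3)[OF assms] by blast
  show ?thesis
    unfolding x(2) by (rule compactin_l_coset[OF convergent_cosetsD(2)[OF assms] x(1)])
qed

text \<open>For large \<open>n\<close> the coset \<open>C n\<close> meets \<open>H\<close>; a
  representative in \<open>H\<close> then gives a coset of \<open>C 0 \<inter> H\<close> inside
  \<open>C n \<inter> H\<close>.\<close>

lemma convergent_cosets_refine:
  assumes C: "convergent_cosets C" and H: "compact_open_subgroup H"
  shows "\<exists>D. convergent_cosets D \<and> D \<le> C \<and> D 0 = C 0 \<inter> H"
proof -
  note sub = convergent_cosetsD(1,2)[OF C] and conv = convergent_cosetsD(4)[OF C]
  have H': "subgroup H G" "openin T H" "compactin T H"
    using H by (auto simp: compact_open_subgroup_def)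
  let ?S = "C 0 \<inter> H"
  have S: "subgroup ?S G"
    using sub(1) H'(1) by (rule subgroups_Inter_pair)
  have one: "\<one> \<in> ?S"
    using S by (rule subgroup.one_closed)
  \<comment> \<open>The representative is taken in \<open>H\<close> where possible and is arbitrary
    elsewhere. At index \<open>0\<close> it is possible, since \<open>C 0\<close> and
    \<open>H\<close> share the identity, so \<open>D 0\<close> is \<open>C 0 \<inter> H\<close>
    itself.\<close>
  have "\<exists>y. y \<in> C n \<and> (C n \<inter> H \<noteq> {} \<longrightarrow> y \<in> H)" for n
    using convergent_cosets_nonempty[OF C, of n] by blast
  then obtain y where y: "\<And>n. y n \<in> C n" "\<And>n. C n \<inter> H \<noteq> {} \<Longrightarrow> y n \<in> H"
    by metis
  have yc: "y n \<in> carrier G" "C n = y n <# C 0" for n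
    using convergent_cosets_eq[OF C y(1)] .
  define D where "D n = y n <# ?S" for n
  have D0: "D 0 = ?S"
  proof -
    have "y 0 \<in> ?S"
      using y(1)[of 0] y(2)[of 0] one by auto
    then show ?thesis
      unfolding D_def by (rule coset_join3[OF yc(1) S])
  qed
  have DC: "D n \<subseteq> C n" for n
    using yc(2)[of n] by (auto simp: D_def l_coset_def)
  \<comment> \<open>As \<open>C 0\<close> is a subgroup, \<open>?U\<close> is the product set of
    \<open>H\<close> and \<open>C 0\<close>: an open neighbourhood of \<open>C 0\<close>, and any
    coset of \<open>C 0\<close> with a point in it meets \<open>H\<close>.\<close>
  let ?U = "\<Union>s\<in>C 0. {y \<in> carrier G. y \<otimes> s \<in> H}"
  have "openin T ?U"
    using H'(2) subgroup.mem_carrier[OF sub(1)] by (auto intro!: openin_right_translate)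
  moreover have "C 0 \<subseteq> ?U"
  proof
    fix s assume s: "s \<in> C 0"
    then have "s \<in> carrier G" "inv s \<in> C 0"
      using sub(1) by (auto intro: subgroup.mem_carrier subgroup.m_inv_closed)
    with one show "s \<in> ?U" by force
  qed
  ultimately obtain M where M: "\<And>n. n \<ge> M \<Longrightarrow> C n \<subseteq> ?U"
    using conv by meson
  have yH: "y n \<in> H" if n: "n \<ge> M" for n
  proof -
    obtain s where "s \<in> C 0" "y n \<otimes> s \<in> H"
      using M[OF n] y(1)[of n] by blast
    moreover from this have "y n \<otimes> s \<in> C n"
      using yc(2)[of n] by (auto simp: l_coset_def)
    ultimately show ?thesis
      using y(2) by blast
  qed
  have "\<exists>N. \<forall>n\<ge>N. D n \<subseteq> U" if U: "openin T U" "D 0 \<subseteq> U" for U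
  proof -
    \<comment> \<open>Adding the open complement of \<open>H\<close> makes a neighbourhood of all of
      \<open>C 0\<close>, to which the convergence of \<open>C\<close> applies. For
      \<open>n \<ge> M\<close> the set \<open>D n\<close> lies in \<open>H\<close>, so only
      \<open>U\<close> remains.\<close>
    have "openin T (U \<union> (topspace T - H))"
      using U(1) compactin_imp_closedin[OF Hausdorff H'(3)] by (auto simp: closedin_def)
    moreover have "C 0 \<subseteq> U \<union> (topspace T - H)"
      using U(2) D0 compactin_subset_topspace[OF sub(2)] by blast
    ultimately obtain N where N: "\<And>n. n \<ge> N \<Longrightarrow> C n \<subseteq> U \<union> (topspace T - H)"
      using conv by meson
    have "D n \<subseteq> U" if "n \<ge> max M N" for n
    proof -
      have "D n \<subseteq> H"
        using yH[of n] that subgroup.m_closed[OF H'(1)] by (auto simp: D_def l_coset_def)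
      with DC[of n] N[of n] that show ?thesis by auto
    qed
    then show ?thesis by blast
  qed
  then have "convergent_cosets D"
    unfolding convergent_cosets_def
    using S yc(1) compactin_Int[OF Hausdorff sub(2) H'(3)] D0
    by (auto simp only: D_def)
  with D0 DC show ?thesis
    by (auto simp: le_fun_def)
qed

text \<open>By compactness the intersection at each index is nonempty, and a point of it represents
  the cosets of all chain members at once. Convergence holds because a neighbourhood of the
  intersection at \<open>0\<close> already contains \<open>C 0\<close> for some chain member
  \<open>C\<close>.\<close>

lemma convergent_cosets_chain_INT:
  assumes ne: "\<C> \<noteq> {}" and conv: "\<And>C. C \<in> \<C> \<Longrightarrow> convergent_cosets C"
    and chain: "\<And>C D. C \<in> \<C> \<Longrightarrow> D \<in> \<C> \<Longrightarrow> C \<le> D \<or> D \<le> C"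
  shows "convergent_cosets (\<lambda>n. \<Inter>C\<in>\<C>. C n)"
proof -
  let ?I = "\<lambda>n. \<Inter>C\<in>\<C>. C n"
  have shrink: "\<exists>C\<in>\<C>. C n \<subseteq> U" if "openin T U" "?I n \<subseteq> U" for n U
  proof -
    have "\<exists>S\<in>(\<lambda>C. C n) ` \<C>. S \<subseteq> U"
    proof (rule compactin_directed_Inter_subset[OF Hausdorff])
      fix A B assume "A \<in> (\<lambda>C. C n) ` \<C>" "B \<in> (\<lambda>C. C n) ` \<C>"
      then obtain C D where "C \<in> \<C>" "D \<in> \<C>" "A = C n" "B = D n" by blast
      with chain[of C D] show "\<exists>E\<in>(\<lambda>C. C n) ` \<C>. E \<subseteq> A \<inter> B"
        unfolding le_fun_def by blast
    qed (use ne conv convergent_cosets_compactin that in auto)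
    then show ?thesis by blast
  qed
  obtain C\<^sub>0 where C\<^sub>0: "C\<^sub>0 \<in> \<C>"
    using ne by blast
  have S: "subgroup (?I 0) G"
  proof (rule subgroups_Inter)
    show "(\<lambda>C. C 0) ` \<C> \<noteq> {}"
      using ne by simp
    show "subgroup H G" if "H \<in> (\<lambda>C. C 0) ` \<C>" for H
      using that convergent_cosetsD(1)[OF conv] by blast
  qed
  have "compactin T (?I 0)"
  proof (rule closed_compactin_Inter)
    show "compactin T (C\<^sub>0 0)" "C\<^sub>0 0 \<in> (\<lambda>C. C 0) ` \<C>"
      using convergent_cosets_compactin[OF conv[OF C\<^sub>0]] C\<^sub>0 by blast+
    show "closedin T K" if "K \<in> (\<lambda>C. C 0) ` \<C>" for K
      using that compactin_imp_closedin[OF Hausdorff convergent_cosets_compactin[OF conv]] by blast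
  qed
  moreover have "\<exists>x\<in>carrier G. ?I n = x <# ?I 0" for n
  proof -
    have "?I n \<noteq> {}"
    proof
      assume "?I n = {}"
      then obtain C where "C \<in> \<C>" "C n \<subseteq> {}"
        using shrink[OF openin_empty, of n] by auto
      then show False
        using convergent_cosets_nonempty[OF conv] by simp
    qed
    then obtain x where x: "\<And>C. C \<in> \<C> \<Longrightarrow> x \<in> C n" by blast
    have xc: "x \<in> carrier G"
      using convergent_cosets_eq(1)[OF conv[OF C\<^sub>0] x[OF C\<^sub>0]] .
    have "C n = x <# C 0" "subgroup (C 0) G" if "C \<in> \<C>" for C
      using convergent_cosets_eq(2)[OF conv[OF that] x[OF that]] convergent_cosetsD(1)[OF conv[OF that]] .
    then have "y \<in> C n \<longleftrightarrow> y \<in> carrier G \<and> inv x \<otimes> y \<in> C 0" if "C \<in> \<C>" for C y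
      using mem_l_coset_iff[OF _ xc, of "C 0"] that by metis
    then have "y \<in> ?I n \<longleftrightarrow> y \<in> x <# ?I 0" for y
      unfolding mem_l_coset_iff[OF S xc] using C\<^sub>0 by blast
    with xc show ?thesis by blast
  qed
  moreover have "\<exists>N. \<forall>n\<ge>N. ?I n \<subseteq> U" if U: "openin T U" "?I 0 \<subseteq> U" for U
  proof -
    obtain C where C: "C \<in> \<C>" "C 0 \<subseteq> U"
      using shrink[OF U] by blast
    then obtain N where "\<forall>n\<ge>N. C n \<subseteq> U"
      using convergent_cosetsD(4)[OF conv[OF C(1)] U(1)] by blast
    with C(1) show ?thesis by blast
  qed
  ultimately show ?thesis
    using S by (simp add: convergent_cosets_def)
qed

text \<open>A minimal system below \<open>C\<close> has trivial subgroup: otherwise refining it by a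
  compact open subgroup that misses a nontrivial element would make it smaller. Its cosets are then
  points converging to the identity.\<close>

lemma convergent_cosets_selection:
  assumes C: "convergent_cosets C"
  obtains x where "\<And>n. x n \<in> C n" "\<And>U. openin T U \<Longrightarrow> \<one> \<in> U \<Longrightarrow> \<exists>N. \<forall>n\<ge>N. x n \<in> U"
proof -
  let ?A = "{D. convergent_cosets D \<and> D \<le> C}"
  have "\<exists>m\<in>?A. \<forall>a\<in>?A. a \<le> m \<longrightarrow> a = m"
  \<comment> \<open>The order is reversed, so the maximal element is a minimal system and upper
    bounds of chains are pointwise intersections.\<close>
  proof (rule predicate_Zorn[where P = "\<lambda>C D. D \<le> C"])
    show "partial_order_on ?A (relation_of (\<lambda>C D. D \<le> C) ?A)"
      by (rule partial_order_on_relation_ofI) auto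
  next
    fix \<C> assume \<C>: "\<C> \<in> Chains (relation_of (\<lambda>C D. D \<le> C) ?A)"
    then have sub: "\<C> \<subseteq> ?A" and chain: "\<And>C D. C \<in> \<C> \<Longrightarrow> D \<in> \<C> \<Longrightarrow> C \<le> D \<or> D \<le> C"
      by (auto simp: Chains_def relation_of_def)
    show "\<exists>u\<in>?A. \<forall>a\<in>\<C>. u \<le> a"
    proof (cases "\<C> = {}")
      case True
      then show ?thesis using C by auto
    next
      case False
      then have "convergent_cosets (\<lambda>n. \<Inter>D\<in>\<C>. D n)"
        using sub chain by (intro convergent_cosets_chain_INT) auto
      moreover have "(\<lambda>n. \<Inter>D\<in>\<C>. D n) \<le> E" if "E \<in> \<C>" for E
        using that by (auto simp: le_fun_def)
      moreover obtain E where "E \<in> \<C>"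
        using False by blast
      ultimately show ?thesis
        using sub by (intro bexI[of _ "\<lambda>n. \<Inter>D\<in>\<C>. D n"]) (auto intro: order_trans)
    qed
  qed
  then obtain D where D: "convergent_cosets D" "D \<le> C"
    and min: "\<And>E. convergent_cosets E \<Longrightarrow> E \<le> D \<Longrightarrow> E = D"
    by (metis (no_types, lifting) mem_Collect_eq order_trans)
  have D0: "D 0 = {\<one>}"
  proof (rule ccontr)
    have S: "subgroup (D 0) G"
      by (rule convergent_cosetsD(1)[OF D(1)])
    assume "D 0 \<noteq> {\<one>}"
    then obtain x where x: "x \<in> D 0" "x \<noteq> \<one>"
      using subgroup.one_closed[OF S] by blast
    then obtain U where U: "openin T U" "\<one> \<in> U" "x \<notin> U"
      using subgroup.mem_carrier[OF S] openin_avoiding by metis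
    obtain H where H: "compact_open_subgroup H" "H \<subseteq> U"
      using compact_open_subgroup_base[OF U(1,2)] by blast
    obtain E where "convergent_cosets E" "E \<le> D" "E 0 = D 0 \<inter> H"
      using convergent_cosets_refine[OF D(1) H(1)] by blast
    with min[of E] x(1) U(3) H(2) show False by blast
  qed
  have "\<forall>n. \<exists>x. x \<in> D n"
    using convergent_cosets_nonempty[OF D(1)] by blast
  then obtain x where x: "\<And>n. x n \<in> D n"
    by metis
  show ?thesis
  proof (rule that[of x])
    show "x n \<in> C n" for n
      using x[of n] D(2) by (auto simp: le_fun_def)
    show "\<exists>N. \<forall>n\<ge>N. x n \<in> U" if "openin T U" "\<one> \<in> U" for U
      using convergent_cosetsD(4)[OF D(1) that(1)] that(2) x unfolding D0 by blast
  qed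
qed

section \<open>Construction of the sequence\<close>

lemma strictly_decreasing_subgroups:
  assumes "T \<noteq> discrete_topology (carrier G)"
  shows "\<exists>N :: nat \<Rightarrow> 'a set. \<forall>n. compact_open_subgroup (N n) \<and> N (Suc n) \<subset> N n"
proof (rule dependent_nat_choice)
  show "\<exists>H. compact_open_subgroup H"
    using compact_open_subgroup_base[of "topspace T"] openin_topspace[of T]
    by (auto simp: topspace_eq_carrier)
next
  fix H and n :: nat assume H: "compact_open_subgroup H"
  then have H': "subgroup H G" "openin T H"
    by (auto simp: compact_open_subgroup_def)
  \<comment> \<open>An open trivial subgroup would make the topology discrete. Hence
    \<open>H\<close> has a nontrivial element, and intersecting with a compact open subgroup that
    misses it makes \<open>H\<close> strictly smaller.\<close>
  have "H \<noteq> {\<one>}"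
    using H'(2) assms openin_one_imp_discrete by blast
  then obtain x where x: "x \<in> H" "x \<noteq> \<one>"
    using subgroup.one_closed[OF H'(1)] by blast
  then obtain U where U: "openin T U" "\<one> \<in> U" "x \<notin> U"
    using subgroup.mem_carrier[OF H'(1)] openin_avoiding by metis
  obtain K where K: "compact_open_subgroup K" "K \<subseteq> U"
    using compact_open_subgroup_base[OF U(1,2)] by blast
  have "H \<inter> K \<subset> H"
    using x(1) U(3) K(2) by blast
  with compact_open_subgroup_Int[OF H K(1)]
  show "\<exists>K. compact_open_subgroup K \<and> K \<subset> H" by blast
qed

text \<open>The \<open>N n\<close> need not form a base at the identity, so the points
  \<open>y n\<close> need not converge to it. Only their cosets of \<open>S\<close> converge, to
  \<open>S\<close>, and the selection lemma replaces each \<open>y n\<close> by a suitable point of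
  its coset.\<close>

theorem exists_unconditionally_f_omega_productive:
  assumes "T \<noteq> discrete_topology (carrier G)"
  shows "\<exists>a. unconditionally_f_omega_productive G T a"
proof -
  obtain N :: "nat \<Rightarrow> 'a set"
    where "\<forall>n. compact_open_subgroup (N n) \<and> N (Suc n) \<subset> N n"
    using strictly_decreasing_subgroups[OF assms] ..
  then have N: "\<And>n. compact_open_subgroup (N n)" "\<And>n. N (Suc n) \<subset> N n"
    by simp_all
  have sN: "subgroup (N n) G" "compactin T (N n)" for n
    using N(1)[of n] by (auto simp: compact_open_subgroup_def)
  have mono: "N m \<subseteq> N n" if "n \<le> m" for m n
    by (rule lift_Suc_antimono_le[of N, OF psubset_imp_subset[OF N(2)] that])
  define S where "S = (\<Inter>n. N n)"
  have S: "subgroup S G"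
    unfolding S_def by (rule subgroups_Inter) (use sN(1) in auto)
  have cS: "compactin T S"
    unfolding S_def
    by (rule closed_compactin_Inter[OF sN(2)[of 0]])
      (use compactin_imp_closedin[OF Hausdorff sN(2)] in auto)
  have "\<forall>n. \<exists>y. y \<in> N n - N (Suc n)"
    using psubset_imp_ex_mem[OF N(2)] by blast
  then obtain y where y: "\<And>n. y n \<in> N n - N (Suc n)"
    by metis
  have yc: "y n \<in> carrier G" for n
    using y[of n] sN(1) by (auto intro: subgroup.mem_carrier)
  \<comment> \<open>Since \<open>S\<close> lies in every \<open>N k\<close>, each layer
    \<open>N n - N (Suc n)\<close> is a union of left cosets of \<open>S\<close>. Thus any selected
    point stays in its layer, which later yields injectivity.\<close>
  have coset: "y n <# S \<subseteq> N n - N (Suc n)" for n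
  proof
    fix z assume z: "z \<in> y n <# S"
    then obtain s where s: "s \<in> S" "z = y n \<otimes> s"
      by (auto simp: l_coset_def)
    have sS: "s \<in> N k" for k
      using s(1) by (auto simp: S_def)
    have "z \<in> N n"
      using y[of n] sS s(2) by (auto intro: subgroup.m_closed[OF sN(1)])
    moreover have "z \<notin> N (Suc n)"
    proof
      assume "z \<in> N (Suc n)"
      then have "z \<otimes> inv s \<in> N (Suc n)"
        using sS by (intro subgroup.m_closed[OF sN(1)] subgroup.m_inv_closed[OF sN(1)])
      moreover have "z \<otimes> inv s = y n"
        using s yc S by (simp add: m_assoc subgroup.mem_carrier)
      ultimately show False
        using y[of n] by simp
    qed
    ultimately show "z \<in> N n - N (Suc n)" by blast
  qed
  \<comment> \<open>Index \<open>0\<close> is reserved for \<open>S\<close>, so the coset of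
    \<open>y n\<close> sits at \<open>Suc n\<close>.\<close>
  define C where "C = case_nat S (\<lambda>n. y n <# S)"
  have "convergent_cosets C"
    unfolding convergent_cosets_def
  proof (intro conjI allI impI)
    fix n show "\<exists>x\<in>carrier G. C n = x <# C 0"
      using yc lcos_mult_one[OF subgroup.subset[OF S]]
      by (cases n) (auto simp: C_def)
  next
    fix U assume U: "openin T U" "C 0 \<subseteq> U"
    \<comment> \<open>The decreasing compact sets \<open>N k\<close> intersect in \<open>S\<close>,
      so one of them lies in \<open>U\<close>; it contains all later cosets.\<close>
    have "\<exists>K\<in>range N. K \<subseteq> U"
    proof (rule compactin_directed_Inter_subset[OF Hausdorff])
      fix A B assume "A \<in> range N" "B \<in> range N"
      then obtain i j where ij: "A = N i" "B = N j" by blast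
      have "N (max i j) \<subseteq> A \<inter> B"
        unfolding ij by (intro Int_greatest mono) simp_all
      then show "\<exists>K\<in>range N. K \<subseteq> A \<inter> B"
        by (rule bexI) (rule rangeI)
    next
      show "range N \<noteq> {}"
        by simp
      show "compactin T K" if "K \<in> range N" for K
        using that sN(2) by (elim imageE) simp
      show "openin T U" "\<Inter>(range N) \<subseteq> U"
        using U by (simp_all add: C_def S_def)
    qed
    then obtain k where k: "N k \<subseteq> U" by blast
    have "C n \<subseteq> U" if n: "n \<ge> Suc k" for n
    proof (cases n)
      case (Suc m)
      then have "C n \<subseteq> N m" "N m \<subseteq> N k"
        using coset[of m] mono[of k m] n by (auto simp: C_def)
      with k show ?thesis by (meson order_trans)
    qed (use n in simp)
    then show "\<exists>k. \<forall>n\<ge>k. C n \<subseteq> U" by blast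
  qed (simp_all add: C_def S cS)
  then obtain x where x: "\<And>n. x n \<in> C n"
      "\<And>U. openin T U \<Longrightarrow> \<one> \<in> U \<Longrightarrow> \<exists>N. \<forall>n\<ge>N. x n \<in> U"
    using convergent_cosets_selection by metis
  \<comment> \<open>The shift drops the point chosen from \<open>S\<close> and realigns
    \<open>a n\<close> with layer \<open>n\<close>.\<close>
  define a where "a n = x (Suc n)" for n
  have a: "a n \<in> N n - N (Suc n)" for n
    using x(1)[of "Suc n"] coset[of n] by (auto simp: a_def C_def)
  have "unconditionally_f_omega_productive G T a"
  proof (rule unconditionally_f_omega_productive_if_tendsto_one)
    show "range a \<subseteq> carrier G"
      using a sN(1) by (auto intro: subgroup.mem_carrier)
    show "inj a"
    proof (rule linorder_injI)
      fix i j :: nat assume "i < j"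
      then have "a j \<in> N (Suc i)"
        using a[of j] mono[of "Suc i" j] by auto
      with a[of i] show "a i \<noteq> a j" by auto
    qed
    fix H assume "compact_open_subgroup H"
    then have "openin T H" "\<one> \<in> H"
      by (auto simp: compact_open_subgroup_def subgroup.one_closed)
    then obtain M where "\<forall>n\<ge>M. x n \<in> H"
      using x(2) by blast
    then show "\<exists>M. \<forall>n\<ge>M. a n \<in> H"
      by (intro exI[of _ M]) (auto simp: a_def)
  qed
  then show ?thesis by blast
qed

end

theorem proposition7p1:
  fixes G :: "('a, 'm) monoid_scheme" and T :: "'a topology"
  assumes "topological_group G T"
    and "T \<noteq> discrete_topology (carrier G)"
    and "locally_compact_space T"
    and "totally_disconnected_space T"
  shows "\<exists>a :: nat \<Rightarrow> 'a. unconditionally_f_omega_productive G T a"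
proof -
  interpret topological_group G T by fact
  \<comment> \<open>Local compactness and total disconnectedness enter through the base of compact
    open subgroups.\<close>
  interpret locally_profinite_group G T
    by unfold_locales (rule van_Dantzig[OF assms(3,4)])
  show ?thesis
    by (rule exists_unconditionally_f_omega_productive[OF assms(2)])
qed

end
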